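(* For any $r\geq 3$ there exists a family of $r$-harmonic curves $\gamma\colon I\to\mathbb{S}^3$ with constant positive geodesic curvature $k$ and constant positive torsion $\tau$.
   Context: Here $r$ is an integer, $\mathbb{S}^3\subset\mathbb{R}^4$ is the unit sphere with its round metric (constant sectional curvature $1$), and $I\subset\mathbb{R}$ is an interval. For a smooth curve $\gamma\colon I\to N$ into a Riemannian manifold $N$, $T=\gamma'$ is its tangent vector, $\nabla_T$ is the covariant derivative along $\gamma$ (induced by the Levi-Civita connection of $N$), and $\nabla_T^jT$ denotes its $j$-fold iterate applied to $T$, with $\nabla_T^0T=T$. The curve $\gamma$ is called $r$-harmonic (polyharmonic of order $r$) if it is a critical point of the $r$-energy $E_r(\gamma)=\int_I|\nabla_T^{r-1}T|^2\,ds$, i.e. if it solves $$\nabla^{2r-1}_TT+\sum_{l=0}^{r-2}(-1)^lR^N(\nabla_T^{2r-3-l}T,\nabla_T^lT)T=0,$$ where $R^N$ is the curvature tensor of $N$, with sign convention such that on a space form of sectional curvature $K$ one has $R^N(X,Y)Z=K(\langle Z,Y\rangle X-\langle Z,X\rangle Y)$. For an arclength-parametrized curve in a three-dimensional space form (such as $\mathbb{S}^3$) with orthonormal Frenet frame $\{T,F_2,F_3\}$, the geodesic curvature $k$ and the torsion $\tau$ are the functions in the Frenet equations $$\nabla_TT=kF_2,\qquad \nabla_TF_2=-kT+\tau F_3,\qquad \nabla_TF_3=-\tau F_2.$$ *)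

theory Defs
  imports "HOL-Analysis.Analysis"
begin

text \<open>
  Derivatives are taken within the interval \<open>I\<close> (one-sided at endpoints belonging to \<open>I\<close>);
  they are meaningful when \<open>I\<close> has more than one point.
\<close>

definition deriv_on :: "real set \<Rightarrow> (real \<Rightarrow> 'a::real_normed_vector) \<Rightarrow> real \<Rightarrow> 'a" where
  "deriv_on I f t = vector_derivative f (at t within I)"

definition smooth_curve_on :: "real set \<Rightarrow> (real \<Rightarrow> 'a::real_normed_vector) \<Rightarrow> bool" where
  "smooth_curve_on I f \<longleftrightarrow> (\<forall>n. \<forall>t\<in>I. (deriv_on I ^^ n) f differentiable (at t within I))"

text \<open>
  The Levi-Civita connection of the round unit sphere is the tangential part of the
  derivative in the ambient Euclidean space, and the normal line at \<open>p\<close> is spanned by \<open>p\<close>.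
  Here \<open>V\<close> is a tangent vector field along the curve \<open>\<gamma>\<close> in \<open>sphere 0 1\<close>.
\<close>

definition cov_deriv ::
    "real set \<Rightarrow> (real \<Rightarrow> 'a::real_inner) \<Rightarrow> (real \<Rightarrow> 'a) \<Rightarrow> real \<Rightarrow> 'a" where
  "cov_deriv I \<gamma> V t = deriv_on I V t - (deriv_on I V t \<bullet> \<gamma> t) *\<^sub>R \<gamma> t"

text \<open>The curvature tensor \<open>R(X,Y)Z\<close> of the unit sphere (sectional curvature 1).\<close>

definition sphere_curv :: "'a::real_inner \<Rightarrow> 'a \<Rightarrow> 'a \<Rightarrow> 'a" where
  "sphere_curv X Y Z = (Z \<bullet> Y) *\<^sub>R X - (Z \<bullet> X) *\<^sub>R Y"

text \<open>
  Polyharmonic curves of order \<open>r \<ge> 1\<close> in the unit sphere, via the Euler-Lagrange equation of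
  the \<open>r\<close>-energy. The sum over \<open>0 \<le> l \<le> r - 2\<close> is written as a sum over \<open>l < r - 1\<close>, so that it
  is empty for \<open>r = 1\<close>.
\<close>

definition polyharmonic_curve :: "nat \<Rightarrow> real set \<Rightarrow> (real \<Rightarrow> 'a::real_inner) \<Rightarrow> bool" where
  "polyharmonic_curve r I \<gamma> \<longleftrightarrow>
     smooth_curve_on I \<gamma> \<and> \<gamma> ` I \<subseteq> sphere 0 1 \<and>
     (\<forall>t\<in>I. let T = deriv_on I \<gamma>; D = (\<lambda>j. (cov_deriv I \<gamma> ^^ j) T t) in
        D (2 * r - 1) +
        (\<Sum>l<r - 1. (- 1) ^ l *\<^sub>R sphere_curv (D (2 * r - 3 - l)) (D l) (T t)) = 0)"

text \<open>
  Curves parametrized by arclength in the unit 3-sphere, with geodesic curvature \<open>\<kappa>\<close> and torsion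
  \<open>\<tau>\<close> with respect to some orthonormal frame \<open>T, F\<^sub>2, F\<^sub>3\<close> of the tangent spaces of the sphere.
  No orientation of the frame is prescribed, so replacing \<open>F\<^sub>3\<close> by its negative changes the
  sign of \<open>\<tau>\<close>.
\<close>

definition frenet_curve_S3 ::
    "real set \<Rightarrow> (real \<Rightarrow> real^4) \<Rightarrow> (real \<Rightarrow> real) \<Rightarrow> (real \<Rightarrow> real) \<Rightarrow> bool" where
  "frenet_curve_S3 I \<gamma> \<kappa> \<tau> \<longleftrightarrow>
     smooth_curve_on I \<gamma> \<and> \<gamma> ` I \<subseteq> sphere 0 1 \<and>
     (\<exists>F2 F3. let T = deriv_on I \<gamma> in
        smooth_curve_on I F2 \<and> smooth_curve_on I F3 \<and>
        (\<forall>t\<in>I.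
           norm (T t) = 1 \<and> norm (F2 t) = 1 \<and> norm (F3 t) = 1 \<and>
           T t \<bullet> F2 t = 0 \<and> T t \<bullet> F3 t = 0 \<and> F2 t \<bullet> F3 t = 0 \<and>
           F2 t \<bullet> \<gamma> t = 0 \<and> F3 t \<bullet> \<gamma> t = 0 \<and>
           cov_deriv I \<gamma> T t = \<kappa> t *\<^sub>R F2 t \<and>
           cov_deriv I \<gamma> F2 t = - \<kappa> t *\<^sub>R T t + \<tau> t *\<^sub>R F3 t \<and>
           cov_deriv I \<gamma> F3 t = - \<tau> t *\<^sub>R F2 t))"

end

theory Submission
  imports Defs
begin

text \<open>
  Along a helix the Frenet equations give \<open>\<nabla>\<^sub>T\<^sup>3T = -(k\<^sup>2 + \<tau>\<^sup>2) \<nabla>\<^sub>TT\<close>, so every iterated covariant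
  derivative is a multiple of \<open>F\<^sub>2\<close> or of \<open>-k T + \<tau> F\<^sub>3\<close>, and the Euler-Lagrange equation of the
  \<open>r\<close>-energy reduces to \<open>(k\<^sup>2 + \<tau>\<^sup>2)\<^sup>2 = (r - 1) k\<^sup>2 + \<tau>\<^sup>2\<close>. With \<open>s = k\<^sup>2 + \<tau>\<^sup>2\<close> the positive solutions
  are \<open>k\<^sup>2 = s (s - 1) / (r - 2)\<close> and \<open>\<tau>\<^sup>2 = s (r - 1 - s) / (r - 2)\<close> for \<open>1 < s < r - 1\<close>.
  Every pair \<open>k, \<tau> > 0\<close> is realised in the 3-sphere by a curve
  \<open>(A cos \<alpha>t, A sin \<alpha>t, B cos \<beta>t, B sin \<beta>t)\<close>, where \<open>\<alpha>\<^sup>2\<close> and \<open>\<beta>\<^sup>2\<close> are the roots of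
  \<open>x\<^sup>2 - (1 + k\<^sup>2 + \<tau>\<^sup>2) x + \<tau>\<^sup>2\<close>.
\<close>

section \<open>Derivatives within a nondegenerate interval\<close>

text \<open>A connected set with more than one point has no isolated points, so a derivative within
  \<open>I\<close> is unique, endpoints included.\<close>

lemma deriv_on_eqI:
  assumes "is_interval I" "interior I \<noteq> {}" "t \<in> I"
    and "(f has_vector_derivative D) (at t within I)"
  shows "deriv_on I f t = D"
proof -
  have "I \<noteq> {x}" for x
    using assms(2) by auto
  then have "t islimpt I"
    using assms(1,3) connected_imp_perfect is_interval_connected by blast
  then show ?thesis
    unfolding deriv_on_def using assms(4)
    by (intro vector_derivative_within) (auto simp: trivial_limit_within)
qed

lemma deriv_on_has_vector_derivative:
  "f differentiable (at t within I) \<Longrightarrow> (f has_vector_derivative deriv_on I f t) (at t within I)"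
  by (simp add: deriv_on_def vector_derivative_works)

lemma smooth_curve_on_imp_differentiable:
  assumes "smooth_curve_on I f" "t \<in> I"
  shows "f differentiable (at t within I)" "deriv_on I f differentiable (at t within I)"
  using assms unfolding smooth_curve_on_def by (metis funpow_0, metis funpow_0 funpow.simps(2) comp_apply)

lemma cov_deriv_eqI:
  assumes "is_interval I" "interior I \<noteq> {}" "t \<in> I"
    and "(V has_vector_derivative D) (at t within I)"
  shows "cov_deriv I \<gamma> V t = D - (D \<bullet> \<gamma> t) *\<^sub>R \<gamma> t"
  using deriv_on_eqI[OF assms] by (simp add: cov_deriv_def)

section \<open>The Euler-Lagrange equation along a helix\<close>

text \<open>Every term of the equation is a multiple of \<open>F2\<close>. The leading derivative,
  the summand \<open>l = 0\<close> and the \<open>r - 2\<close> other summands, which are all equal,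
  have the common factor \<open>c ^ (r - 3) * k\<close>; what remains vanishes by
  \<open>eq\<close>.\<close>

lemma helix_polyharmonic:
  assumes I: "is_interval I" "interior I \<noteq> {}"
    and r: "r \<ge> 3"
    and frenet: "frenet_curve_S3 I \<gamma> (\<lambda>_. k) (\<lambda>_. \<tau>)"
    and eq: "(k\<^sup>2 + \<tau>\<^sup>2)\<^sup>2 = (real r - 1) * k\<^sup>2 + \<tau>\<^sup>2"
  shows "polyharmonic_curve r I \<gamma>"
proof -
  define T where "T = deriv_on I \<gamma>"
  \<comment> \<open>Differentiating twice multiplies both \<open>F2\<close> and
    \<open>- k T + \<tau> F3\<close> by \<open>c\<close>.\<close>
  define c where "c = - (k\<^sup>2 + \<tau>\<^sup>2)"
  from frenet obtain F2 F3 where smooth: "smooth_curve_on I \<gamma>" "smooth_curve_on I F2" "smooth_curve_on I F3"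
    and sph: "\<gamma> ` I \<subseteq> sphere 0 1"
    and orth: "\<And>t. t \<in> I \<Longrightarrow> norm (T t) = 1" "\<And>t. t \<in> I \<Longrightarrow> T t \<bullet> F2 t = 0"
      "\<And>t. t \<in> I \<Longrightarrow> T t \<bullet> F3 t = 0"
    and covT: "\<And>t. t \<in> I \<Longrightarrow> cov_deriv I \<gamma> T t = k *\<^sub>R F2 t"
    and covF2: "\<And>t. t \<in> I \<Longrightarrow> cov_deriv I \<gamma> F2 t = - k *\<^sub>R T t + \<tau> *\<^sub>R F3 t"
    and covF3: "\<And>t. t \<in> I \<Longrightarrow> cov_deriv I \<gamma> F3 t = - \<tau> *\<^sub>R F2 t"
    unfolding frenet_curve_S3_def T_def Let_def by blast
  have cov: "cov_deriv I \<gamma> V t = (x * k - z * \<tau>) *\<^sub>R F2 t + y *\<^sub>R (- k *\<^sub>R T t + \<tau> *\<^sub>R F3 t)"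
    if V: "\<And>t. t \<in> I \<Longrightarrow> V t = x *\<^sub>R T t + y *\<^sub>R F2 t + z *\<^sub>R F3 t" and t: "t \<in> I" for V x y z t
  proof -
    note der = deriv_on_has_vector_derivative smooth_curve_on_imp_differentiable smooth t
    have "((\<lambda>t. x *\<^sub>R T t + y *\<^sub>R F2 t + z *\<^sub>R F3 t) has_vector_derivative
        x *\<^sub>R deriv_on I T t + y *\<^sub>R deriv_on I F2 t + z *\<^sub>R deriv_on I F3 t) (at t within I)"
      unfolding T_def by (auto intro!: derivative_eq_intros der)
    then have "(V has_vector_derivative
        x *\<^sub>R deriv_on I T t + y *\<^sub>R deriv_on I F2 t + z *\<^sub>R deriv_on I F3 t) (at t within I)"
      using V t by (subst has_vector_derivative_cong_ev[where g="\<lambda>t. x *\<^sub>R T t + y *\<^sub>R F2 t + z *\<^sub>R F3 t"]) auto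
    from deriv_on_eqI[OF I t this] have "cov_deriv I \<gamma> V t =
        x *\<^sub>R cov_deriv I \<gamma> T t + y *\<^sub>R cov_deriv I \<gamma> F2 t + z *\<^sub>R cov_deriv I \<gamma> F3 t"
      by (simp add: cov_deriv_def inner_add_left algebra_simps)
    then show ?thesis
      using t by (simp add: covT covF2 covF3 algebra_simps)
  qed
  define D where "D = (\<lambda>j t. (cov_deriv I \<gamma> ^^ j) T t)"
  have D_Suc: "D (Suc j) = cov_deriv I \<gamma> (D j)" for j
    by (simp add: D_def)
  have D0: "D 0 t = T t" for t
    by (simp add: D_def)
  \<comment> \<open>The pattern starts at index 1: \<open>D 0 = T\<close> does not fit it, so the
    summand \<open>l = 0\<close> is treated separately as \<open>f0\<close>.\<close>
  have D: "(\<forall>t\<in>I. D (2 * m + 1) t = (c ^ m * k) *\<^sub>R F2 t) \<and>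
      (\<forall>t\<in>I. D (2 * m + 2) t = (c ^ m * k) *\<^sub>R (- k *\<^sub>R T t + \<tau> *\<^sub>R F3 t))" for m
  proof (induction m)
    case 0
    have 1: "D 1 t = k *\<^sub>R F2 t" if "t \<in> I" for t
      using D_Suc[of 0] covT[OF that] by (simp add: D_def)
    moreover have "D 2 t = k *\<^sub>R (- k *\<^sub>R T t + \<tau> *\<^sub>R F3 t)" if "t \<in> I" for t
      using D_Suc[of 1] cov[of "D 1" 0 k 0, OF _ that] 1 by (simp add: numeral_2_eq_2)
    ultimately show ?case by (simp add: numeral_2_eq_2)
  next
    case (Suc m)
    have eq: "D (2 * m + 2) t = - (c ^ m * k * k) *\<^sub>R T t + 0 *\<^sub>R F2 t + (c ^ m * k * \<tau>) *\<^sub>R F3 t"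
      if "t \<in> I" for t
      using Suc that by (simp add: algebra_simps)
    have c_Suc: "- (c ^ m * k * k) * k - c ^ m * k * \<tau> * \<tau> = c ^ Suc m * k"
      by (simp add: c_def power2_eq_square algebra_simps)
    have 1: "D (2 * Suc m + 1) t = (c ^ Suc m * k) *\<^sub>R F2 t" if "t \<in> I" for t
      using D_Suc[of "2 * m + 2"] cov[OF eq that] unfolding c_Suc by simp
    moreover have "D (2 * Suc m + 2) t = (c ^ Suc m * k) *\<^sub>R (- k *\<^sub>R T t + \<tau> *\<^sub>R F3 t)"
      if "t \<in> I" for t
      using D_Suc[of "2 * Suc m + 1"] cov[of "D (2 * Suc m + 1)" 0 "c ^ Suc m * k" 0, OF _ that] 1 by simp
    ultimately show ?case by blast
  qed
  have odd: "D (2 * m + 1) t = (c ^ m * k) *\<^sub>R F2 t" if "t \<in> I" for m t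
    using D that by blast
  have even: "T t \<bullet> D (2 * m + 2) t = - (c ^ m * k\<^sup>2)" if "t \<in> I" for m t
    using D[of m] orth[OF that] that
    by (simp add: inner_diff_right inner_add_right norm_eq_1 power2_eq_square)
  have T_odd: "T t \<bullet> D (2 * m + 1) t = 0" if "t \<in> I" for m t
    using odd[OF that] orth[OF that] by simp
  obtain n where n: "r = n + 3"
    using r by (metis add.commute le_Suc_ex)
  have "D (2 * r - 1) t + (\<Sum>l<r - 1. (- 1) ^ l *\<^sub>R sphere_curv (D (2 * r - 3 - l) t) (D l t) (T t)) = 0"
    if t: "t \<in> I" for t
  proof -
    let ?f = "\<lambda>l. (- 1) ^ l *\<^sub>R sphere_curv (D (2 * r - 3 - l) t) (D l t) (T t)"
    have f0: "?f 0 = (c ^ (n + 1) * k) *\<^sub>R F2 t"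
      using odd[OF t, of "n + 1"] T_odd[OF t, of "n + 1"] orth[OF t]
      by (simp add: n sphere_curv_def D0 norm_eq_1 numeral_3_eq_3)
    \<comment> \<open>The two indices add up to the odd number \<open>2 * r - 3\<close>, so exactly
      one of the derivatives is a multiple of \<open>F2\<close>, hence orthogonal to
      \<open>T\<close>, and one curvature term survives. Its sign alternates with the parity of
      \<open>l\<close>, which cancels the alternating factor.\<close>
    have f_Suc: "?f (Suc l) = - (c ^ n * k ^ 3) *\<^sub>R F2 t" if l: "l < n + 1" for l
    proof (cases "even l")
      case True
      then obtain m where m: "l = 2 * m" by (elim evenE)
      obtain j where j: "n = m + j" using l m by (metis Suc_eq_plus1 le_Suc_ex less_Suc_eq_le le_add2 mult_2 order.trans)
      have idx: "2 * r - 3 - Suc l = 2 * j + 2" using j m n by simp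
      show ?thesis
        using odd[OF t, of m] orth(2)[OF t] even[OF t, of j]
        unfolding idx by (simp add: m j sphere_curv_def power_add power2_eq_square power3_eq_cube ac_simps)
    next
      case False
      then obtain m where m: "l = 2 * m + 1" by (elim oddE)
      obtain j where j: "n = m + j" using l m by (metis le_Suc_ex less_Suc_eq_le Suc_eq_plus1 le_add2 mult_2 order.trans trans_le_add1)
      have idx: "2 * r - 3 - Suc l = 2 * j + 1" using j m n by simp
      show ?thesis
        using odd[OF t, of j] orth(2)[OF t] even[OF t, of m]
        unfolding idx by (simp add: m j sphere_curv_def power_add power2_eq_square power3_eq_cube ac_simps)
    qed
    have "r - 1 = Suc (n + 1)" by (simp add: n)
    then have "(\<Sum>l<r - 1. ?f l) = ?f 0 + (\<Sum>l<n + 1. ?f (Suc l))"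
      using sum.lessThan_Suc_shift[of ?f "n + 1"] by presburger
    also have "(\<Sum>l<n + 1. ?f (Suc l)) = (\<Sum>l<n + 1. - (c ^ n * k ^ 3) *\<^sub>R F2 t)"
      using f_Suc by (intro sum.cong) auto
    also have "\<dots> = (- real (n + 1) * c ^ n * k ^ 3) *\<^sub>R F2 t"
      by (simp only: sum_constant_scaleR card_lessThan scaleR_scaleR) (simp add: algebra_simps)
    finally have sum: "(\<Sum>l<r - 1. ?f l) = (c ^ (n + 1) * k - real (n + 1) * c ^ n * k ^ 3) *\<^sub>R F2 t"
      unfolding f0 by (simp add: algebra_simps)
    have "2 * r - 1 = 2 * (n + 2) + 1" by (simp add: n)
    then have last: "D (2 * r - 1) t = (c ^ (n + 2) * k) *\<^sub>R F2 t"
      using odd[OF t, of "n + 2"] by presburger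
    \<comment> \<open>Here \<open>n + 1 = r - 2\<close>; this is \<open>eq\<close> after moving one
      copy of \<open>k\<^sup>2 + \<tau>\<^sup>2\<close> to the left.\<close>
    have "c\<^sup>2 + c - real (n + 1) * k\<^sup>2 = 0"
      unfolding c_def power2_minus eq by (simp add: n algebra_simps)
    then have "c ^ n * k * (c\<^sup>2 + c - real (n + 1) * k\<^sup>2) = 0" by simp
    then have "c ^ (n + 2) * k + (c ^ (n + 1) * k - real (n + 1) * c ^ n * k ^ 3) = 0"
      by (simp add: power_add power2_eq_square power3_eq_cube algebra_simps)
    then show ?thesis
      unfolding sum last by (metis scaleR_add_left scaleR_zero_left)
  qed
  then show ?thesis
    using smooth(1) sph unfolding polyharmonic_curve_def Let_def D_def T_def by simp
qed

section \<open>Orbits on flat tori in the 3-sphere\<close>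

text \<open>
  The curves \<open>(z e\<^sup>i\<^sup>a\<^sup>t, w e\<^sup>i\<^sup>b\<^sup>t)\<close> with \<open>z = p + i q\<close> and \<open>w = u + i v\<close>: a family closed under
  differentiation, on which the inner product is that of the coefficients.
\<close>

definition torus_orbit :: "real \<Rightarrow> real \<Rightarrow> real \<Rightarrow> real \<Rightarrow> real \<Rightarrow> real \<Rightarrow> real \<Rightarrow> real^4" where
  "torus_orbit a b p q u v t =
     (p * cos (a * t) - q * sin (a * t)) *\<^sub>R axis 1 1 + (p * sin (a * t) + q * cos (a * t)) *\<^sub>R axis 2 1 +
     (u * cos (b * t) - v * sin (b * t)) *\<^sub>R axis 3 1 + (u * sin (b * t) + v * cos (b * t)) *\<^sub>R axis 4 1"

lemma has_vector_derivative_torus_orbit: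
  "(torus_orbit a b p q u v has_vector_derivative
     torus_orbit a b (- a * q) (a * p) (- b * v) (b * u) t) (at t within I)"
  unfolding torus_orbit_def
  by (rule derivative_eq_intros refl | simp add: algebra_simps)+

lemma inner_torus_orbit:
  "torus_orbit a b p q u v t \<bullet> torus_orbit a b p' q' u' v' t = p * p' + q * q' + u * u' + v * v'"
proof -
  have rot: "(x' * cos s - y' * sin s) * (x * cos s - y * sin s) +
      (x' * sin s + y' * cos s) * (x * sin s + y * cos s) = x * x' + y * y'" for x y x' y' s :: real
  proof -
    have "(x' * cos s - y' * sin s) * (x * cos s - y * sin s) +
      (x' * sin s + y' * cos s) * (x * sin s + y * cos s) =
      (x * x' + y * y') * ((sin s)\<^sup>2 + (cos s)\<^sup>2)"
      by algebra
    then show ?thesis by simp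
  qed
  show ?thesis
    using rot[of p' "a * t" q' p q] rot[of u' "b * t" v' u v]
    by (simp add: torus_orbit_def inner_add_left inner_add_right inner_axis_axis)
qed

lemma torus_orbit_lincomb:
  "x *\<^sub>R torus_orbit a b p q u v t + y *\<^sub>R torus_orbit a b p' q' u' v' t =
     torus_orbit a b (x * p + y * p') (x * q + y * q') (x * u + y * u') (x * v + y * v') t"
  by (simp add: torus_orbit_def algebra_simps)

lemma deriv_on_torus_orbit:
  assumes "is_interval I" "interior I \<noteq> {}" "t \<in> I"
  shows "deriv_on I (torus_orbit a b p q u v) t = torus_orbit a b (- a * q) (a * p) (- b * v) (b * u) t"
  by (rule deriv_on_eqI[OF assms has_vector_derivative_torus_orbit])

lemma smooth_torus_orbit:
  assumes I: "is_interval I" "interior I \<noteq> {}"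
  shows "smooth_curve_on I (torus_orbit a b p q u v)"
proof -
  have eq: "\<exists>p' q' u' v'. \<forall>t\<in>I. (deriv_on I ^^ n) (torus_orbit a b p q u v) t = torus_orbit a b p' q' u' v' t" for n
  proof (induction n)
    case 0
    show ?case by auto
  next
    case (Suc n)
    then obtain p' q' u' v' where eq: "\<And>t. t \<in> I \<Longrightarrow> (deriv_on I ^^ n) (torus_orbit a b p q u v) t = torus_orbit a b p' q' u' v' t"
      by blast
    have "(deriv_on I ^^ Suc n) (torus_orbit a b p q u v) t = torus_orbit a b (- a * q') (a * p') (- b * v') (b * u') t"
      if t: "t \<in> I" for t
    proof -
      have "((deriv_on I ^^ n) (torus_orbit a b p q u v) has_vector_derivative
          torus_orbit a b (- a * q') (a * p') (- b * v') (b * u') t) (at t within I)"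
        by (rule has_vector_derivative_transform[OF t _ has_vector_derivative_torus_orbit]) (use eq in auto)
      then show ?thesis using deriv_on_eqI[OF I t] by simp
    qed
    then show ?case by blast
  qed
  show ?thesis
    unfolding smooth_curve_on_def
  proof (intro allI ballI)
    fix n t assume t: "t \<in> I"
    obtain p' q' u' v' where "\<And>t. t \<in> I \<Longrightarrow> (deriv_on I ^^ n) (torus_orbit a b p q u v) t = torus_orbit a b p' q' u' v' t"
      using eq by blast
    then have "((deriv_on I ^^ n) (torus_orbit a b p q u v) has_vector_derivative
          torus_orbit a b (- a * q') (a * p') (- b * v') (b * u') t) (at t within I)"
      by (intro has_vector_derivative_transform[OF t _ has_vector_derivative_torus_orbit]) auto
    then show "(deriv_on I ^^ n) (torus_orbit a b p q u v) differentiable at t within I"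
      by (rule differentiableI_vector)
  qed
qed

text \<open>The curve lies on the torus with radii \<open>A\<close> and \<open>B\<close>.
  \<open>F2\<close> is the unit normal of that torus in the sphere, and \<open>F3\<close> is tangent
  to the torus and orthogonal to \<open>T\<close>. The hypotheses \<open>kB\<close> and
  \<open>kA\<close> are the two components of \<open>\<gamma>'' + \<gamma> = k F2\<close>.\<close>

lemma frenet_torus_orbit:
  assumes I: "is_interval I" "interior I \<noteq> {}"
    and unit: "A\<^sup>2 + B\<^sup>2 = 1" and speed: "(\<alpha> * A)\<^sup>2 + (\<beta> * B)\<^sup>2 = 1"
    and kB: "A * (\<alpha>\<^sup>2 - 1) = k * B" and kA: "B * (1 - \<beta>\<^sup>2) = k * A"
  shows "frenet_curve_S3 I (torus_orbit \<alpha> \<beta> A 0 B 0) (\<lambda>_. k) (\<lambda>_. \<alpha> * \<beta>)"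
proof -
  let ?\<gamma> = "torus_orbit \<alpha> \<beta> A 0 B 0"
  let ?T = "torus_orbit \<alpha> \<beta> 0 (\<alpha> * A) 0 (\<beta> * B)"
  let ?F2 = "torus_orbit \<alpha> \<beta> (- B) 0 A 0"
  let ?F3 = "torus_orbit \<alpha> \<beta> 0 (- \<beta> * B) 0 (\<alpha> * A)"
  have T: "deriv_on I ?\<gamma> t = ?T t" if "t \<in> I" for t
    using deriv_on_torus_orbit[OF I that, of \<alpha> \<beta> A 0 B 0] by simp
  have der_T: "(deriv_on I ?\<gamma> has_vector_derivative torus_orbit \<alpha> \<beta> (- \<alpha> * (\<alpha> * A)) (\<alpha> * 0) (- \<beta> * (\<beta> * B)) (\<beta> * 0) t) (at t within I)"
    if "t \<in> I" for t
    by (rule has_vector_derivative_transform[OF that _ has_vector_derivative_torus_orbit]) (use T in auto)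
  have speed': "\<alpha> * (\<alpha> * A) * A + \<beta> * (\<beta> * B) * B = 1"
    using speed by (simp add: power2_eq_square algebra_simps)
  have covT: "cov_deriv I ?\<gamma> (deriv_on I ?\<gamma>) t = k *\<^sub>R ?F2 t" if t: "t \<in> I" for t
  proof -
    \<comment> \<open>Unit speed on the unit sphere forces
      \<open>\<gamma>'' \<bullet> \<gamma> = - 1\<close>, so the tangential projection adds
      \<open>\<gamma>\<close>.\<close>
    have "torus_orbit \<alpha> \<beta> (- \<alpha> * (\<alpha> * A)) (\<alpha> * 0) (- \<beta> * (\<beta> * B)) (\<beta> * 0) t \<bullet> ?\<gamma> t = - 1"
      unfolding inner_torus_orbit using speed' by simp
    then have "cov_deriv I ?\<gamma> (deriv_on I ?\<gamma>) t =
        1 *\<^sub>R torus_orbit \<alpha> \<beta> (- \<alpha> * (\<alpha> * A)) (\<alpha> * 0) (- \<beta> * (\<beta> * B)) (\<beta> * 0) t + 1 *\<^sub>R ?\<gamma> t"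
      unfolding cov_deriv_eqI[OF I t der_T[OF t]] by simp
    also have "\<dots> = torus_orbit \<alpha> \<beta> (k * - B) 0 (k * A) 0 t"
    proof -
      have "1 * (- \<alpha> * (\<alpha> * A)) + 1 * A = k * - B" "1 * (- \<beta> * (\<beta> * B)) + 1 * B = k * A"
        using kA kB by algebra+
      then show ?thesis
        unfolding torus_orbit_lincomb by simp
    qed
    finally show ?thesis
      using torus_orbit_lincomb[of k \<alpha> \<beta> "-B" 0 A 0 t 0] by simp
  qed
  have covF2: "cov_deriv I ?\<gamma> ?F2 t = - k *\<^sub>R ?T t + (\<alpha> * \<beta>) *\<^sub>R ?F3 t" if t: "t \<in> I" for t
  proof -
    have e1: "\<alpha> * - B = - k * (\<alpha> * A) + \<alpha> * \<beta> * (- \<beta> * B)" using kA by algebra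
    have e2: "\<beta> * A = - k * (\<beta> * B) + \<alpha> * \<beta> * (\<alpha> * A)" using kB by algebra
    show ?thesis
      unfolding cov_deriv_eqI[OF I t has_vector_derivative_torus_orbit] torus_orbit_lincomb e1 e2
      by (simp add: inner_torus_orbit)
  qed
  have covF3: "cov_deriv I ?\<gamma> ?F3 t = - (\<alpha> * \<beta>) *\<^sub>R ?F2 t" if t: "t \<in> I" for t
    using torus_orbit_lincomb[of "- (\<alpha> * \<beta>)" \<alpha> \<beta> "-B" 0 A 0 t 0]
    unfolding cov_deriv_eqI[OF I t has_vector_derivative_torus_orbit]
    by (simp add: inner_torus_orbit algebra_simps)
  have "?\<gamma> ` I \<subseteq> sphere 0 1"
    using unit by (auto simp: norm_eq_1 inner_torus_orbit power2_eq_square)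
  moreover have "norm (?T t) = 1 \<and> norm (?F2 t) = 1 \<and> norm (?F3 t) = 1 \<and>
      ?T t \<bullet> ?F2 t = 0 \<and> ?T t \<bullet> ?F3 t = 0 \<and> ?F2 t \<bullet> ?F3 t = 0 \<and>
      ?F2 t \<bullet> ?\<gamma> t = 0 \<and> ?F3 t \<bullet> ?\<gamma> t = 0" for t
    using unit speed by (simp add: norm_eq_1 inner_torus_orbit power2_eq_square algebra_simps)
  ultimately show ?thesis
    unfolding frenet_curve_S3_def Let_def
    using smooth_torus_orbit[OF I] covT covF2 covF3 T by metis
qed

section \<open>Helices with prescribed curvature and torsion\<close>

text \<open>Root of the discriminant
  \<open>(1 + k\<^sup>2 + \<tau>\<^sup>2)\<^sup>2 - 4 \<tau>\<^sup>2\<close> of the quadratic for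
  the squared frequencies, rewritten as a sum of squares so that positivity is visible.\<close>

definition helix_disc :: "real \<Rightarrow> real \<Rightarrow> real" where
  "helix_disc k \<tau> = sqrt ((k\<^sup>2 + \<tau>\<^sup>2 - 1)\<^sup>2 + 4 * k\<^sup>2)"

text \<open>The radii solve \<open>A\<^sup>2 + B\<^sup>2 = 1\<close> together with unit speed:
  \<open>A\<^sup>2 = (1 - \<beta>\<^sup>2) / d\<close> and
  \<open>B\<^sup>2 = (\<alpha>\<^sup>2 - 1) / d\<close>, where
  \<open>d = \<alpha>\<^sup>2 - \<beta>\<^sup>2\<close>.\<close>

definition S3_helix :: "real \<Rightarrow> real \<Rightarrow> real \<Rightarrow> real^4" where
  "S3_helix k \<tau> = (let s = k\<^sup>2 + \<tau>\<^sup>2; d = helix_disc k \<tau> in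
     torus_orbit (sqrt ((1 + s + d) / 2)) (sqrt ((1 + s - d) / 2))
       (sqrt ((d + 1 - s) / (2 * d))) 0 (sqrt ((d + s - 1) / (2 * d))) 0)"

text \<open>This bound makes the radicands of both radii positive and separates the frequencies:
  \<open>\<beta>\<^sup>2 < 1 < \<alpha>\<^sup>2\<close>.\<close>

lemma helix_disc_gt:
  assumes "k \<noteq> 0"
  shows "\<bar>k\<^sup>2 + \<tau>\<^sup>2 - 1\<bar> < helix_disc k \<tau>"
  unfolding helix_disc_def using assms by (intro real_less_rsqrt) simp

lemma frenet_S3_helix:
  assumes I: "is_interval I" "interior I \<noteq> {}" and k: "k > 0" and \<tau>: "\<tau> > 0"
  shows "frenet_curve_S3 I (S3_helix k \<tau>) (\<lambda>_. k) (\<lambda>_. \<tau>)"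
proof -
  define s d where "s = k\<^sup>2 + \<tau>\<^sup>2" and "d = helix_disc k \<tau>"
  define \<alpha> \<beta> A B where "\<alpha> = sqrt ((1 + s + d) / 2)" and "\<beta> = sqrt ((1 + s - d) / 2)"
    and "A = sqrt ((d + 1 - s) / (2 * d))" and "B = sqrt ((d + s - 1) / (2 * d))"
  have d: "\<bar>s - 1\<bar> < d"
    using helix_disc_gt[of k \<tau>] k by (simp add: s_def d_def)
  then have d0: "d > 0" by linarith
  have s0: "s > 0" using k by (simp add: s_def add_pos_nonneg)
  have d2: "d\<^sup>2 = (s - 1)\<^sup>2 + 4 * k\<^sup>2"
    by (simp add: d_def s_def helix_disc_def)
  \<comment> \<open>The product of the two roots is \<open>\<tau>\<^sup>2\<close>; this yields both
    \<open>d < 1 + s\<close> and the torsion \<open>\<alpha> * \<beta> = \<tau>\<close>.\<close>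
  have d2': "(1 + s)\<^sup>2 - d\<^sup>2 = 4 * \<tau>\<^sup>2"
    unfolding d2 by (simp add: s_def power2_eq_square algebra_simps)
  have "d\<^sup>2 < (1 + s)\<^sup>2" using d2' \<tau> by (smt (verit) zero_less_power)
  then have ds: "d < 1 + s" using s0 by (simp add: power2_less_imp_less)
  have \<alpha>: "\<alpha>\<^sup>2 = (1 + s + d) / 2" and \<beta>: "\<beta>\<^sup>2 = (1 + s - d) / 2"
    and A: "A\<^sup>2 = (d + 1 - s) / (2 * d)" and B: "B\<^sup>2 = (d + s - 1) / (2 * d)"
    using d d0 s0 ds by (simp_all add: \<alpha>_def \<beta>_def A_def B_def)
  have nn: "\<alpha> \<ge> 0" "\<beta> \<ge> 0" "A \<ge> 0" "B \<ge> 0"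
    using d d0 s0 ds by (simp_all add: \<alpha>_def \<beta>_def A_def B_def)
  have prod: "(d + s - 1) * (d + 1 - s) = 4 * k\<^sup>2"
    using d2 by (simp add: power2_eq_square algebra_simps)
  have "(\<alpha> * \<beta>)\<^sup>2 = \<tau>\<^sup>2"
    using d2' unfolding power_mult_distrib \<alpha> \<beta> by (simp add: power2_eq_square field_simps)
  then have \<tau>eq: "\<alpha> * \<beta> = \<tau>"
    using nn \<tau> by (simp add: power2_eq_iff_nonneg)
  have unit: "A\<^sup>2 + B\<^sup>2 = 1"
    using d0 by (simp add: A B field_simps)
  have speed: "(\<alpha> * A)\<^sup>2 + (\<beta> * B)\<^sup>2 = 1"
    using d0 by (simp add: power_mult_distrib A B \<alpha> \<beta> field_simps)
  \<comment> \<open>Both sides of \<open>kB\<close>, and later of \<open>kA\<close>, are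
    nonnegative, so comparing squares suffices; \<open>prod\<close> brings in
    \<open>k\<close>.\<close>
  have "(A * (\<alpha>\<^sup>2 - 1))\<^sup>2 = ((d + s - 1) * (d + 1 - s)) * (d + s - 1) / (8 * d)"
    unfolding power_mult_distrib A \<alpha> using d0 by (simp add: power2_eq_square field_simps)
  also have "\<dots> = (k * B)\<^sup>2"
    using d0 by (simp add: prod power_mult_distrib B)
  finally have kB: "A * (\<alpha>\<^sup>2 - 1) = k * B"
    using nn k d by (subst (asm) power2_eq_iff_nonneg) (auto simp: \<alpha>)
  have "(B * (1 - \<beta>\<^sup>2))\<^sup>2 = ((d + s - 1) * (d + 1 - s)) * (d + 1 - s) / (8 * d)"
    unfolding power_mult_distrib B \<beta> using d0 by (simp add: power2_eq_square field_simps)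
  also have "\<dots> = (k * A)\<^sup>2"
    using d0 by (simp add: prod power_mult_distrib A)
  finally have kA: "B * (1 - \<beta>\<^sup>2) = k * A"
    using nn k d by (subst (asm) power2_eq_iff_nonneg) (auto simp: \<beta>)
  have "S3_helix k \<tau> = torus_orbit \<alpha> \<beta> A 0 B 0"
    by (simp add: S3_helix_def Let_def s_def d_def \<alpha>_def \<beta>_def A_def B_def)
  then show ?thesis
    using frenet_torus_orbit[OF I unit speed kB kA] by (simp add: \<tau>eq)
qed

text \<open>Nonvanishing \<open>k\<close> keeps \<open>helix_disc\<close> away from zero, so the
  quotients inside the radii are continuous.\<close>

lemma continuous_on_S3_helix:
  fixes k \<tau> f :: "'a::t2_space \<Rightarrow> real"
  assumes "continuous_on S k" "continuous_on S \<tau>" "continuous_on S f" "\<And>x. x \<in> S \<Longrightarrow> k x \<noteq> 0"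
  shows "continuous_on S (\<lambda>x. S3_helix (k x) (\<tau> x) (f x))"
proof -
  have "helix_disc (k x) (\<tau> x) \<noteq> 0" if "x \<in> S" for x
    using helix_disc_gt[of "k x" "\<tau> x"] assms(4)[OF that] by linarith
  moreover have "continuous_on S (\<lambda>x. helix_disc (k x) (\<tau> x))"
    unfolding helix_disc_def by (intro continuous_intros assms)
  ultimately show ?thesis
    unfolding S3_helix_def torus_orbit_def Let_def by (intro continuous_intros assms) simp_all
qed

section \<open>The one-parameter family\<close>

theorem corollary1p4:
  fixes r :: nat and I :: "real set"
  assumes "r \<ge> 3" and "is_interval I" and "interior I \<noteq> {}"
  shows "\<exists>(a::real) (b::real) (\<gamma> :: real \<Rightarrow> real \<Rightarrow> real^4) (k :: real \<Rightarrow> real) (\<tau> :: real \<Rightarrow> real).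
           a < b \<and>
           continuous_on ({a<..<b} \<times> I) (\<lambda>(s, t). \<gamma> s t) \<and>
           continuous_on {a<..<b} k \<and> continuous_on {a<..<b} \<tau> \<and>
           inj_on (\<lambda>s. (k s, \<tau> s)) {a<..<b} \<and>
           (\<forall>s\<in>{a<..<b}. k s > 0 \<and> \<tau> s > 0 \<and>
              polyharmonic_curve r I (\<gamma> s) \<and>
              frenet_curve_S3 I (\<gamma> s) (\<lambda>_. k s) (\<lambda>_. \<tau> s))"
proof -
  \<comment> \<open>The parameter is \<open>s = k\<^sup>2 + \<tau>\<^sup>2\<close>; on
    \<open>J\<close> both radicands below are positive.\<close>
  define J where "J = {1<..<real r - 1}"
  define z where "z = real r - 2"
  have z: "z > 0" and r_z: "real r = z + 2"
    using assms(1) by (simp_all add: z_def)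
  define k \<tau> where "k s = sqrt (s * (s - 1) / (real r - 2))"
    and "\<tau> s = sqrt (s * (real r - 1 - s) / (real r - 2))" for s
  have pos: "k s > 0 \<and> \<tau> s > 0" if "s \<in> J" for s
    using that assms(1) by (auto simp: k_def \<tau>_def J_def)
  have sq: "(k s)\<^sup>2 = s * (s - 1) / (real r - 2)" "(\<tau> s)\<^sup>2 = s * (real r - 1 - s) / (real r - 2)"
    if "s \<in> J" for s
    using that assms(1) by (auto simp: k_def \<tau>_def J_def)
  have s_eq: "(k s)\<^sup>2 + (\<tau> s)\<^sup>2 = s" if "s \<in> J" for s
    unfolding sq[OF that] r_z using z by (simp add: field_simps)
  have harm: "((k s)\<^sup>2 + (\<tau> s)\<^sup>2)\<^sup>2 = (real r - 1) * (k s)\<^sup>2 + (\<tau> s)\<^sup>2" if "s \<in> J" for s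
    unfolding s_eq[OF that] sq[OF that] r_z using z by (simp add: field_simps power2_eq_square)
  have cont: "continuous_on S k" "continuous_on S \<tau>" for S
    unfolding k_def \<tau>_def using assms(1) by (intro continuous_intros; auto)+
  have "continuous_on (J \<times> I) (\<lambda>x. S3_helix (k (fst x)) (\<tau> (fst x)) (snd x))"
    using pos by (intro continuous_on_S3_helix continuous_on_compose2[OF cont(1)[of UNIV]]
        continuous_on_compose2[OF cont(2)[of UNIV]] continuous_intros) force+
  \<comment> \<open>The pair determines the parameter, since \<open>s_eq\<close> recovers
    \<open>s\<close> from it.\<close>
  moreover have "inj_on (\<lambda>s. (k s, \<tau> s)) J"
    by (rule inj_onI) (metis s_eq prod.inject)
  moreover have "frenet_curve_S3 I (S3_helix (k s) (\<tau> s)) (\<lambda>_. k s) (\<lambda>_. \<tau> s)" if "s \<in> J" for s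
    using frenet_S3_helix assms(2,3) pos[OF that] by blast
  moreover have "polyharmonic_curve r I (S3_helix (k s) (\<tau> s))" if "s \<in> J" for s
    using calculation(3) helix_polyharmonic assms harm that by blast
  moreover have "1 < real r - 1"
    using assms(1) by linarith
  ultimately show ?thesis
    using pos cont unfolding J_def case_prod_unfold
    by (intro exI[of _ 1] exI[of _ "real r - 1"] exI[of _ "\<lambda>s. S3_helix (k s) (\<tau> s)"]
        exI[of _ k] exI[of _ \<tau>]) simp
qed

end
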